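(* Let $G$ be a Hausdorff topological group whose underlying space is paracompact and an $F$-space, with $\dim G<\infty$ and $\psi(G)\le\omega$. Then $G$ contains an open Boolean subgroup $H$ which is itself a paracompact topological $F$-group with $\dim H<\infty$ and $\psi(H)\le\omega$.
   Context: All spaces are Tychonoff (completely regular Hausdorff). A space $X$ is an $F$-space if any two disjoint cozero sets in $X$ are completely (functionally) separated in $X$. $\dim X$ denotes the Čech covering dimension: the least integer $n\ge -1$ such that every finite open cover of $X$ has a finite open refinement of order $n$ (and $\infty$ if no such $n$ exists). $\psi(G)$ is the pseudocharacter; for a topological group, $\psi(G)\le\omega$ means that the identity element is a $G_\delta$-set. A group is Boolean if all its elements satisfy $x^2=1$. *)

theory Defs
  imports "HOL-Analysis.Analysis" "HOL-Algebra.Group"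
begin

definition topological_group :: "('a, 'b) monoid_scheme \<Rightarrow> 'a topology \<Rightarrow> bool" where
  "topological_group G T \<longleftrightarrow>
     group G \<and> topspace T = carrier G \<and>
     continuous_map (prod_topology T T) T (\<lambda>(x, y). x \<otimes>\<^bsub>G\<^esub> y) \<and>
     continuous_map T T (\<lambda>x. inv\<^bsub>G\<^esub> x)"

definition paracompact_space :: "'a topology \<Rightarrow> bool" where
  "paracompact_space X \<longleftrightarrow>
     (\<forall>\<U>. (\<forall>U\<in>\<U>. openin X U) \<and> \<Union>\<U> = topspace X \<longrightarrow>
        (\<exists>\<V>. (\<forall>V\<in>\<V>. openin X V) \<and> \<Union>\<V> = topspace X \<and>
             locally_finite_in X \<V> \<and> (\<forall>V\<in>\<V>. \<exists>U\<in>\<U>. V \<subseteq> U)))"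

definition cozero_in :: "'a topology \<Rightarrow> 'a set \<Rightarrow> bool" where
  "cozero_in X C \<longleftrightarrow>
     (\<exists>f::'a \<Rightarrow> real. continuous_map X euclideanreal f \<and> C = {x \<in> topspace X. f x \<noteq> 0})"

definition completely_separated_in :: "'a topology \<Rightarrow> 'a set \<Rightarrow> 'a set \<Rightarrow> bool" where
  "completely_separated_in X A B \<longleftrightarrow>
     (\<exists>f::'a \<Rightarrow> real. continuous_map X (top_of_set {0..1}) f \<and> f ` A \<subseteq> {0} \<and> f ` B \<subseteq> {1})"

definition F_space :: "'a topology \<Rightarrow> bool" where
  "F_space X \<longleftrightarrow>
     (\<forall>A B. cozero_in X A \<and> cozero_in X B \<and> A \<inter> B = {} \<longrightarrow> completely_separated_in X A B)"

definition covering_dim_le :: "'a topology \<Rightarrow> nat \<Rightarrow> bool" where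
  "covering_dim_le X n \<longleftrightarrow>
     (\<forall>\<U>. finite \<U> \<and> (\<forall>U\<in>\<U>. openin X U) \<and> \<Union>\<U> = topspace X \<longrightarrow>
        (\<exists>\<V>. finite \<V> \<and> (\<forall>V\<in>\<V>. openin X V) \<and> \<Union>\<V> = topspace X \<and>
             (\<forall>V\<in>\<V>. \<exists>U\<in>\<U>. V \<subseteq> U) \<and>
             (\<forall>x\<in>topspace X. card {V\<in>\<V>. x \<in> V} \<le> n + 1)))"

definition finite_covering_dim :: "'a topology \<Rightarrow> bool" where
  "finite_covering_dim X \<longleftrightarrow> (\<exists>n. covering_dim_le X n)"

definition countable_pseudocharacter :: "('a, 'b) monoid_scheme \<Rightarrow> 'a topology \<Rightarrow> bool" where
  "countable_pseudocharacter G T \<longleftrightarrow> gdelta_in T {\<one>\<^bsub>G\<^esub>}"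

end

theory Submission
  imports Defs
begin

text \<open>
  The points of order at most two are the fixed points of inversion \<open>h\<close>, and they form a
  \<open>G\<^sub>\<delta>\<close>-set. If this set is open, then a neighbourhood \<open>V\<close> of the identity with
  \<open>V \<union> V V\<close> inside it consists of commuting involutions and lies in a Boolean subgroup.

  Openness holds for every involution \<open>h\<close> of a finite-dimensional paracompact \<open>F\<close>-space whose
  fixed-point set is \<open>G\<^sub>\<delta>\<close>. It suffices to find finitely many continuous odd functions
  (\<open>u \<circ> h = - u\<close>) whose common zeros are the fixed points: the disjoint cozero sets \<open>u > 0\<close> and
  \<open>u < 0\<close> are completely separated and exchanged by \<open>h\<close>, so \<open>u\<close> vanishes near each fixed
  point. Paracompactness first yields countably many such functions \<open>g\<^sub>k\<close>, with values in
  \<open>[-1, 1]\<close>. On each set where \<open>\<Sum>\<^sub>k 2\<^sup>-\<^sup>k \<bar>g\<^sub>k\<bar>\<close> is bounded away from zero finitely many of them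
  suffice, and the covering dimension bounds their number after refinement, uniformly in the set.
  Layers on which this sum is comparable to a given constant are then glued, those of even and
  those of odd index separately.
\<close>

section \<open>Normality and cover functions in paracompact spaces\<close>

lemma regular_space_closure_nhd:
  assumes "regular_space X" "openin X U" "x \<in> U"
  obtains W where "openin X W" "x \<in> W" "X closure_of W \<subseteq> U"
proof -
  have "neighbourhood_base_of (closedin X) X"
    using assms(1) by (simp add: neighbourhood_base_of_closedin)
  then have "\<exists>W C. openin X W \<and> closedin X C \<and> x \<in> W \<and> W \<subseteq> C \<and> C \<subseteq> U"
    using assms(2,3) unfolding neighbourhood_base_of by blast
  then show thesis
    using that closure_of_minimal by (metis subset_trans)
qed

lemma paracompact_spaceE:
  assumes "paracompact_space X" "\<And>U. U \<in> \<U> \<Longrightarrow> openin X U" "topspace X \<subseteq> \<Union>\<U>"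
  obtains \<V> where "\<forall>V\<in>\<V>. openin X V" "\<Union>\<V> = topspace X"
    "locally_finite_in X \<V>" "\<forall>V\<in>\<V>. \<exists>U\<in>\<U>. V \<subseteq> U"
proof -
  have "\<Union>\<U> = topspace X"
    using assms(2,3) openin_subset by (metis Sup_least subset_antisym)
  then show thesis
    using assms(1,2) that unfolding paracompact_space_def by metis
qed

text \<open>Closure commutes with locally finite unions. Refine the cover by the complement of
  \<open>A\<close> and the open sets with closure inside \<open>U\<close>: the refining sets that
  meet \<open>A\<close> then have a union whose closure is still inside \<open>U\<close>.\<close>

lemma paracompact_regular_imp_normal_space:
  assumes pc: "paracompact_space X" and reg: "regular_space X"
  shows "normal_space X"
  unfolding normal_space_alt
proof (intro allI impI, elim conjE)
  fix A U assume A: "closedin X A" and U: "openin X U" and AU: "A \<subseteq> U"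
  let ?\<C> = "insert (topspace X - A) {W. openin X W \<and> X closure_of W \<subseteq> U}"
  have nb: "\<exists>W. openin X W \<and> x \<in> W \<and> X closure_of W \<subseteq> U" if "x \<in> A" for x
    using regular_space_closure_nhd[OF reg U, of x] that AU by (metis subsetD)
  have op: "\<And>W. W \<in> ?\<C> \<Longrightarrow> openin X W"
    using A by auto
  have cov: "topspace X \<subseteq> \<Union>?\<C>"
    using nb by blast
  obtain \<V> where \<V>: "\<forall>V\<in>\<V>. openin X V" "\<Union>\<V> = topspace X"
      "locally_finite_in X \<V>" "\<forall>V\<in>\<V>. \<exists>W\<in>?\<C>. V \<subseteq> W"
    by (rule paracompact_spaceE[OF pc op cov])
  define \<A> where "\<A> = {V\<in>\<V>. V \<inter> A \<noteq> {}}"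
  have cl: "X closure_of V \<subseteq> U" if "V \<in> \<A>" for V
  proof -
    have "V \<in> \<V>" "V \<inter> A \<noteq> {}"
      using that by (auto simp: \<A>_def)
    then obtain W where "V \<subseteq> W" "X closure_of W \<subseteq> U"
      using \<V>(4) by blast
    then show ?thesis
      by (meson closure_of_mono subset_trans)
  qed
  have "locally_finite_in X \<A>"
    using \<V>(3) by (rule locally_finite_in_subset) (auto simp: \<A>_def)
  then have "X closure_of \<Union>\<A> \<subseteq> U"
    using cl by (simp add: closure_of_locally_finite_Union SUP_le_iff)
  moreover have "openin X (\<Union>\<A>)"
    using \<V>(1) by (auto simp: \<A>_def)
  moreover have "A \<subseteq> \<Union>\<A>"
    using closedin_subset[OF A] \<V>(2) unfolding \<A>_def by blast
  ultimately show "\<exists>V. openin X V \<and> A \<subseteq> V \<and> X closure_of V \<subseteq> U"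
    by blast
qed

text \<open>A substitute for a partition of unity: instead of the sum being 1, some function equals
  1 at each point, which later makes an odd difference nonzero there. The cover is shrunk to closed
  sets, and Urysohn's lemma is applied to each member separately.\<close>

lemma paracompact_cover_functions:
  assumes pc: "paracompact_space X" and reg: "regular_space X"
    and op: "\<And>U. U \<in> \<U> \<Longrightarrow> openin X U" and cov: "\<Union>\<U> = topspace X"
  obtains \<phi> :: "'a set \<Rightarrow> 'a \<Rightarrow> real"
  where "\<And>U. U \<in> \<U> \<Longrightarrow> continuous_map X euclideanreal (\<phi> U)"
    and "\<And>U x. \<lbrakk>U \<in> \<U>; x \<in> topspace X - U\<rbrakk> \<Longrightarrow> \<phi> U x = 0"
    and "\<And>x. x \<in> topspace X \<Longrightarrow> \<exists>U\<in>\<U>. x \<in> U \<and> \<phi> U x = 1"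
proof -
  have normal: "normal_space X"
    by (rule paracompact_regular_imp_normal_space[OF pc reg])
  let ?\<C> = "{W. openin X W \<and> (\<exists>U\<in>\<U>. X closure_of W \<subseteq> U)}"
  have "\<exists>W\<in>?\<C>. x \<in> W" if x: "x \<in> topspace X" for x
  proof -
    obtain U where U: "U \<in> \<U>" "x \<in> U"
      using x cov by blast
    then obtain W where "openin X W" "x \<in> W" "X closure_of W \<subseteq> U"
      using regular_space_closure_nhd[OF reg op[OF U(1)] U(2)] by metis
    then show ?thesis
      using U(1) by blast
  qed
  then have cov\<C>: "topspace X \<subseteq> \<Union>?\<C>"
    by blast
  have op\<C>: "\<And>W. W \<in> ?\<C> \<Longrightarrow> openin X W"
    by simp
  obtain \<V> where \<V>: "\<forall>V\<in>\<V>. openin X V" "\<Union>\<V> = topspace X"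
      "locally_finite_in X \<V>" "\<forall>V\<in>\<V>. \<exists>W\<in>?\<C>. V \<subseteq> W"
    by (rule paracompact_spaceE[OF pc op\<C> cov\<C>])
  \<comment> \<open>\<open>C U\<close> is closed as the union of a locally finite family of
    closures. The sets \<open>C U\<close> cover the space because every member of \<V> has its
    closure inside some \<open>U\<close>.\<close>
  define C where "C U = \<Union>((closure_of) X ` {V\<in>\<V>. X closure_of V \<subseteq> U})" for U
  have clC: "closedin X (C U)" for U
    unfolding C_def
    by (rule closedin_Union_locally_finite_closure, rule locally_finite_in_subset[OF \<V>(3)]) auto
  have CU: "C U \<subseteq> U" for U
    by (auto simp: C_def)
  have "\<exists>f. continuous_map X euclideanreal f \<and> f ` (C U) \<subseteq> {1} \<and> f ` (topspace X - U) \<subseteq> {0::real}"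
    if "U \<in> \<U>" for U
  proof -
    have "closedin X (topspace X - U)" "disjnt (C U) (topspace X - U)"
      using op[OF that] CU[of U] by (auto simp: disjnt_def)
    then show ?thesis
      using Urysohn_lemma_alt[OF normal clC] by metis
  qed
  then obtain \<phi> :: "'a set \<Rightarrow> 'a \<Rightarrow> real" where \<phi>: "\<And>U. U \<in> \<U> \<Longrightarrow>
      continuous_map X euclideanreal (\<phi> U) \<and> \<phi> U ` (C U) \<subseteq> {1} \<and> \<phi> U ` (topspace X - U) \<subseteq> {0}"
    by metis
  show ?thesis
  proof
    show "\<exists>U\<in>\<U>. x \<in> U \<and> \<phi> U x = 1" if x: "x \<in> topspace X" for x
    proof -
      obtain V where V: "V \<in> \<V>" "x \<in> V"
        using x \<V>(2) by blast
      obtain W where W: "W \<in> ?\<C>" "V \<subseteq> W"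
        using \<V>(4)[rule_format, OF V(1)] by (rule bexE)
      then obtain U where "X closure_of W \<subseteq> U" and U: "U \<in> \<U>"
        by blast
      with W have "X closure_of V \<subseteq> U"
        by (meson closure_of_mono subset_trans)
      moreover have "x \<in> X closure_of V"
        using V(2) closure_of_subset[OF openin_subset[of X V]] V(1) \<V>(1) by auto
      ultimately have "x \<in> C U"
        unfolding C_def using V(1) by blast
      then show ?thesis
        using \<phi>[OF U] CU U by blast
    qed
  qed (use \<phi> in blast)+
qed

section \<open>Odd functions with respect to an involution\<close>

definition odd_function :: "'a topology \<Rightarrow> ('a \<Rightarrow> 'a) \<Rightarrow> ('a \<Rightarrow> real) \<Rightarrow> bool" where
  "odd_function X h g \<longleftrightarrow>
     continuous_map X euclideanreal g \<and> (\<forall>x\<in>topspace X. g (h x) = - g x)"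

definition involution :: "'a topology \<Rightarrow> ('a \<Rightarrow> 'a) \<Rightarrow> bool" where
  "involution X h \<longleftrightarrow> continuous_map X X h \<and> (\<forall>x\<in>topspace X. h (h x) = x)"

lemma involution_in_topspace:
  "\<lbrakk>involution X h; x \<in> topspace X\<rbrakk> \<Longrightarrow> h x \<in> topspace X"
  unfolding involution_def continuous_map_def by blast

text \<open>If \<open>V\<close> is disjoint from its image under \<open>h\<close>, then
  \<open>\<phi> V x - \<phi> V (h x)\<close> is odd in \<open>x\<close> and nonzero wherever
  \<open>\<phi> V\<close> is 1 on \<open>V\<close>. At \<open>x\<close> only members containing
  \<open>x\<close> or \<open>h x\<close> can give a nonzero difference, and their number bounds the
  index \<open>k\<close>. Members that miss \<open>A\<close> may meet their own image, so the cover
  can also reach the fixed points.\<close>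

lemma odd_functions_of_locally_finite_cover:
  assumes pc: "paracompact_space X" and reg: "regular_space X" and inv: "involution X h"
    and op: "\<And>V. V \<in> \<V> \<Longrightarrow> openin X V" and cov: "\<Union>\<V> = topspace X"
    and lf: "locally_finite_in X \<V>"
    and A: "A \<subseteq> topspace X"
    and free: "\<And>V x. \<lbrakk>V \<in> \<V>; V \<inter> A \<noteq> {}; x \<in> V\<rbrakk> \<Longrightarrow> h x \<notin> V"
  shows "\<exists>g :: nat \<Rightarrow> 'a \<Rightarrow> real. (\<forall>k. odd_function X h (g k)) \<and>
    (\<forall>x\<in>A. \<exists>k < card {V\<in>\<V>. x \<in> V} + card {V\<in>\<V>. h x \<in> V}. g k x \<noteq> 0)"
proof -
  obtain \<phi> :: "'a set \<Rightarrow> 'a \<Rightarrow> real"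
    where \<phi>: "\<And>U. U \<in> \<V> \<Longrightarrow> continuous_map X euclideanreal (\<phi> U)"
    and \<phi>0: "\<And>U x. \<lbrakk>U \<in> \<V>; x \<in> topspace X - U\<rbrakk> \<Longrightarrow> \<phi> U x = 0"
    and \<phi>1: "\<And>x. x \<in> topspace X \<Longrightarrow> \<exists>U\<in>\<V>. x \<in> U \<and> \<phi> U x = 1"
    using paracompact_cover_functions[OF pc reg op cov] by blast
  have hX: "continuous_map X X h" and hh: "\<And>x. x \<in> topspace X \<Longrightarrow> h (h x) = x"
    using inv by (auto simp: involution_def)
  note htop = involution_in_topspace[OF inv]
  \<comment> \<open>If \<^term>\<open>x\<close> has exactly \<^term>\<open>Suc k\<close> nonvanishing \<^term>\<open>\<alpha> V x\<close>, then the sum \<^term>\<open>g k x\<close>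
    below has exactly one term, and that term is nonzero: this replaces a locally finite family
    of odd functions by a sequence, finite if the cover has finite order.\<close>
  define \<alpha> where "\<alpha> V x = \<phi> V x - \<phi> V (h x)" for V x
  define supp where "supp x = {V\<in>\<V>. \<alpha> V x \<noteq> 0}" for x
  define c :: "'a set set \<Rightarrow> 'a set" where "c S = (SOME V. V \<in> S)" for S
  \<comment> \<open>The single signed factor makes the term odd whatever the size of
    \<open>S\<close>. The absolute values are invariant under \<open>h\<close>, and their product
    kills the term as soon as a member of a finite \<open>S\<close> leaves the support; this gives
    continuity.\<close>
  define t where "t x S = \<alpha> (c S) x * (\<Prod>V\<in>S. \<bar>\<alpha> V x\<bar>)" for x S
  define g where "g k x = (\<Sum>S | S \<subseteq> supp x \<and> card S = Suc k. t x S)" for k x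
  have c: "c S \<in> S" if "card S = Suc k" for S k
  proof -
    have "S \<noteq> {}"
      using that by auto
    then show ?thesis
      by (simp add: c_def some_in_eq)
  qed
  have \<alpha>: "continuous_map X euclideanreal (\<alpha> V)" if "V \<in> \<V>" for V
    unfolding \<alpha>_def
    using continuous_map_compose[OF hX \<phi>[OF that]] \<phi>[OF that]
    by (intro continuous_map_diff) (auto simp: o_def)
  have \<alpha>h: "\<alpha> V (h x) = - \<alpha> V x" if "x \<in> topspace X" for V x
    using that by (simp add: \<alpha>_def hh)
  have supp_sub: "supp x \<subseteq> {V\<in>\<V>. x \<in> V} \<union> {V\<in>\<V>. h x \<in> V}" if "x \<in> topspace X" for x
  proof
    fix V assume V: "V \<in> supp x"
    then have "\<phi> V x \<noteq> 0 \<or> \<phi> V (h x) \<noteq> 0" "V \<in> \<V>"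
      by (auto simp: supp_def \<alpha>_def)
    then show "V \<in> {V\<in>\<V>. x \<in> V} \<union> {V\<in>\<V>. h x \<in> V}"
      using \<phi>0[of V x] \<phi>0[of V "h x"] that htop by blast
  qed
  have fin: "finite {V\<in>\<V>. x \<in> V}" if x: "x \<in> topspace X" for x
  proof -
    obtain W where "x \<in> W" "finite {U \<in> \<V>. U \<inter> W \<noteq> {}}"
      using lf x unfolding locally_finite_in_def by meson
    then show ?thesis
      by (elim rev_finite_subset) blast
  qed
  have odd: "odd_function X h (g k)" for k
    unfolding odd_function_def
  proof (intro conjI ballI)
    \<comment> \<open>Near \<open>x\<close>, supports stay inside one finite set: the members that
      meet a suitable neighbourhood of \<open>x\<close> or, because of the composition with
      \<open>h\<close>, one of \<open>h x\<close>.\<close>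
    have "\<exists>N F. openin X N \<and> x \<in> N \<and> finite F \<and> F \<subseteq> \<V> \<and> (\<forall>y\<in>N. supp y \<subseteq> F)"
      if x: "x \<in> topspace X" for x
    proof -
      obtain O1 where O1: "openin X O1" "x \<in> O1" "finite {U \<in> \<V>. U \<inter> O1 \<noteq> {}}"
        using lf x unfolding locally_finite_in_def by meson
      obtain O2 where O2: "openin X O2" "h x \<in> O2" "finite {U \<in> \<V>. U \<inter> O2 \<noteq> {}}"
        using lf htop[OF x] unfolding locally_finite_in_def by meson
      define N where "N = O1 \<inter> {y\<in>topspace X. h y \<in> O2}"
      define F where "F = {U \<in> \<V>. U \<inter> O1 \<noteq> {}} \<union> {U \<in> \<V>. U \<inter> O2 \<noteq> {}}"
      have "openin X N"
        unfolding N_def using O1 O2 hX by (simp add: openin_Int openin_continuous_map_preimage)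
      moreover have "x \<in> N"
        using x O1 O2 by (simp add: N_def)
      moreover have "finite F" "F \<subseteq> \<V>"
        using O1 O2 by (auto simp: F_def)
      moreover have "supp y \<subseteq> F" if "y \<in> N" for y
        using supp_sub[of y] that unfolding F_def N_def by blast
      ultimately show ?thesis by blast
    qed
    then obtain N F where N: "\<And>x. x \<in> topspace X \<Longrightarrow> openin X (N x)"
        "\<And>x. x \<in> topspace X \<Longrightarrow> x \<in> N x"
      and F: "\<And>x. x \<in> topspace X \<Longrightarrow> finite (F x)"
        "\<And>x. x \<in> topspace X \<Longrightarrow> F x \<subseteq> \<V>"
        "\<And>x y. \<lbrakk>x \<in> topspace X; y \<in> N x\<rbrakk> \<Longrightarrow> supp y \<subseteq> F x"
      by metis
    define f where "f x y = (\<Sum>S | S \<subseteq> F x \<and> card S = Suc k. t y S)" for x y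
    \<comment> \<open>Replacing subsets of \<open>supp y\<close> by subsets of \<open>F x\<close>
      adds only zero terms and makes the index set independent of \<open>y\<close>.\<close>
    have gf: "g k y = f x y" if x: "x \<in> topspace X" and y: "y \<in> N x" for x y
      unfolding g_def f_def
    proof (rule sum.mono_neutral_left)
      show "finite {S. S \<subseteq> F x \<and> card S = Suc k}"
        using F(1)[OF x] by simp
      show "{S. S \<subseteq> supp y \<and> card S = Suc k} \<subseteq> {S. S \<subseteq> F x \<and> card S = Suc k}"
        using F(3)[OF x y] by blast
      show "\<forall>S\<in>{S. S \<subseteq> F x \<and> card S = Suc k} - {S. S \<subseteq> supp y \<and> card S = Suc k}. t y S = 0"
      proof
        fix S assume S: "S \<in> {S. S \<subseteq> F x \<and> card S = Suc k} - {S. S \<subseteq> supp y \<and> card S = Suc k}"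
        then obtain V where "V \<in> S" "V \<notin> supp y"
          by blast
        moreover have "V \<in> \<V>" "finite S"
          using S F(1,2)[OF x] \<open>V \<in> S\<close> finite_subset by blast+
        ultimately show "t y S = 0"
          by (force simp: t_def supp_def)
      qed
    qed
    have contt: "continuous_map X euclideanreal (\<lambda>y. t y S)"
      if "x \<in> topspace X" "S \<subseteq> F x" "card S = Suc k" for x S
    proof -
      have "finite S" "S \<subseteq> \<V>"
        using that F(1,2) finite_subset by blast+
      then show ?thesis
        unfolding t_def using c[OF that(3)] \<alpha>
        by (intro continuous_map_real_mult continuous_map_prod continuous_map_real_abs) auto
    qed
    have contf: "continuous_map X euclideanreal (f x)" if "x \<in> topspace X" for x
      unfolding f_def using F(1)[OF that] contt[OF that]
      by (intro continuous_map_sum) auto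
    show "continuous_map X euclideanreal (g k)"
    proof (rule pasting_lemma[where I = "topspace X" and T = N and f = f])
      show "openin X (N x)" if "x \<in> topspace X" for x
        using N(1) that .
      show "continuous_map (subtopology X (N x)) euclideanreal (f x)" if "x \<in> topspace X" for x
        using contf[OF that] by (rule continuous_map_from_subtopology)
      show "f x z = f y z" if "x \<in> topspace X" "y \<in> topspace X" "z \<in> topspace X \<inter> N x \<inter> N y"
        for x y z
        using gf[of x z] gf[of y z] that by simp
      show "\<exists>y. y \<in> topspace X \<and> x \<in> N y \<and> g k x = f y x" if "x \<in> topspace X" for x
        using that N(2) gf by blast
    qed
  next
    fix x assume x: "x \<in> topspace X"
    have "supp (h x) = supp x"
      using \<alpha>h[OF x] by (simp add: supp_def)
    then show "g k (h x) = - g k x"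
      by (simp add: g_def t_def \<alpha>h[OF x] sum_negf)
  qed
  have "\<exists>k < card {V\<in>\<V>. x \<in> V} + card {V\<in>\<V>. h x \<in> V}. g k x \<noteq> 0" if x: "x \<in> A" for x
  proof -
    have xt: "x \<in> topspace X"
      using x A by blast
    have finS: "finite (supp x)"
      using supp_sub[OF xt] fin[OF xt] fin[OF htop[OF xt]] finite_subset by blast
    obtain U where U: "U \<in> \<V>" "x \<in> U" "\<phi> U x = 1"
      using \<phi>1[OF xt] by blast
    then have "h x \<in> topspace X - U"
      using free[of U x] x htop[OF xt] by blast
    then have "U \<in> supp x"
      using U \<phi>0 by (simp add: supp_def \<alpha>_def)
    then obtain k where k: "card (supp x) = Suc k"
      using finS by (metis card_Suc_Diff1)
    have "{S. S \<subseteq> supp x \<and> card S = Suc k} = {supp x}"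
      using k card_subset_eq[OF finS] by auto
    then have "g k x = t x (supp x)"
      by (simp add: g_def)
    also have "\<dots> \<noteq> 0"
      using c[OF k] finS by (auto simp: t_def supp_def)
    finally have "g k x \<noteq> 0" .
    moreover have "card (supp x) \<le> card ({V\<in>\<V>. x \<in> V} \<union> {V\<in>\<V>. h x \<in> V})"
      using supp_sub[OF xt] fin[OF xt] fin[OF htop[OF xt]] by (intro card_mono) auto
    then have "k < card {V\<in>\<V>. x \<in> V} + card {V\<in>\<V>. h x \<in> V}"
      using k card_Un_le[of "{V\<in>\<V>. x \<in> V}" "{V\<in>\<V>. h x \<in> V}"] by linarith
    ultimately show ?thesis by blast
  qed
  with odd show ?thesis
    by blast
qed

lemma continuous_map_suminf_geometric:
  fixes f :: "nat \<Rightarrow> 'a \<Rightarrow> real"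
  assumes cont: "\<And>n. continuous_map X euclideanreal (f n)"
    and bound: "\<And>n x. x \<in> topspace X \<Longrightarrow> \<bar>f n x\<bar> \<le> (1/2) ^ n"
  shows "continuous_map X euclideanreal (\<lambda>x. \<Sum>n. f n x)"
proof -
  have lim: "uniform_limit (topspace X) (\<lambda>n x. \<Sum>i<n. f i x) (\<lambda>x. \<Sum>i. f i x) sequentially"
    using bound by (intro Weierstrass_m_test[where M = "\<lambda>n. (1/2) ^ n"]) auto
  have "continuous_map X (Met_TC.mtopology) (\<lambda>x. \<Sum>n. f n x)"
  proof (rule Met_TC.continuous_map_uniform_limit[where F = sequentially])
    show "\<forall>\<^sub>F n in sequentially. continuous_map X Met_TC.mtopology (\<lambda>x. \<Sum>i<n. f i x)"
      using cont by (intro always_eventually allI) (simp add: continuous_map_sum)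
    show "\<forall>\<^sub>F n in sequentially. \<forall>x\<in>topspace X.
        (\<Sum>i. f i x) \<in> UNIV \<and> dist (\<Sum>i<n. f i x) (\<Sum>i. f i x) < \<epsilon>" if "0 < \<epsilon>" for \<epsilon>
      using uniform_limitD[OF lim that] by simp
  qed simp
  then show ?thesis by simp
qed

lemma odd_function_clamp:
  assumes "odd_function X h g"
  shows "odd_function X h (\<lambda>x. max (- 1) (min 1 (g x)))"
  using assms unfolding odd_function_def
  by (auto intro!: continuous_map_real_max continuous_map_real_min)

text \<open>The complement of the fixed points is an F-sigma set. Each of its closed pieces
  \<open>C m\<close> gets a sequence of odd functions from a locally finite cover, and the double
  sequence is enumerated by \<open>prod_decode\<close>.\<close>

lemma countable_odd_functions:
  assumes pc: "paracompact_space X" and reg: "regular_space X" and haus: "Hausdorff_space X"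
    and inv: "involution X h"
    and gdelta: "gdelta_in X {x\<in>topspace X. h x = x}"
  obtains g :: "nat \<Rightarrow> 'a \<Rightarrow> real"
  where "\<And>k. odd_function X h (g k)"
    and "\<And>x. \<lbrakk>x \<in> topspace X; h x \<noteq> x\<rbrakk> \<Longrightarrow> \<exists>k. g k x \<noteq> 0"
proof -
  have hX: "continuous_map X X h"
    using inv by (auto simp: involution_def)
  have "fsigma_in X (topspace X - {x\<in>topspace X. h x = x})"
    using gdelta gdelta_in_fsigma_in by blast
  then obtain C where "(\<forall>m. closedin X (C m)) \<and> (\<forall>m. C m \<subseteq> C (Suc m)) \<and>
      \<Union>(range C) = topspace X - {x\<in>topspace X. h x = x}"
    unfolding fsigma_in_ascending ..
  then have C: "\<forall>m. closedin X (C m)"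
    and CU: "\<Union>(range C) = topspace X - {x\<in>topspace X. h x = x}"
    by simp_all
  have "\<exists>g :: nat \<Rightarrow> 'a \<Rightarrow> real. (\<forall>k. odd_function X h (g k)) \<and> (\<forall>x\<in>C m. \<exists>k. g k x \<noteq> 0)" for m
  proof -
    have Cm: "closedin X (C m)" "C m \<subseteq> topspace X" "\<And>x. x \<in> C m \<Longrightarrow> h x \<noteq> x"
      using C CU closedin_subset by auto
    \<comment> \<open>A refining set that meets \<open>C m\<close> is not inside the complement of
      \<open>C m\<close>, so it lies in some \<open>W\<close> that \<open>h\<close> moves off
      itself.\<close>
    let ?\<C> = "insert (topspace X - C m) {W. openin X W \<and> (\<forall>y\<in>W. h y \<notin> W)}"
    have op: "\<And>W. W \<in> ?\<C> \<Longrightarrow> openin X W"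
      using Cm by auto
    have "\<exists>W\<in>?\<C>. x \<in> W" if x: "x \<in> C m" for x
    proof -
      have "x \<in> topspace X" "h x \<in> topspace X" "h x \<noteq> x"
        using x Cm involution_in_topspace[OF inv] by auto
      then obtain U U' where U: "openin X U" "openin X U'" "x \<in> U" "h x \<in> U'" "disjnt U U'"
        using haus unfolding Hausdorff_space_def by metis
      define W where "W = U \<inter> {y\<in>topspace X. h y \<in> U'}"
      have "openin X W"
        unfolding W_def using U hX by (simp add: openin_Int openin_continuous_map_preimage)
      moreover have "x \<in> W" "\<forall>y\<in>W. h y \<notin> W"
        using U \<open>x \<in> topspace X\<close> by (auto simp: W_def disjnt_iff)
      ultimately show ?thesis by blast
    qed
    then have cov: "topspace X \<subseteq> \<Union>?\<C>"
      by blast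
    obtain \<V> where \<V>: "\<forall>V\<in>\<V>. openin X V" "\<Union>\<V> = topspace X"
      "locally_finite_in X \<V>" "\<forall>V\<in>\<V>. \<exists>W\<in>?\<C>. V \<subseteq> W"
      by (rule paracompact_spaceE[OF pc op cov])
    have free: "h x \<notin> V" if "V \<in> \<V>" "V \<inter> C m \<noteq> {}" "x \<in> V" for V x
    proof -
      obtain W where "W \<in> ?\<C>" "V \<subseteq> W"
        using \<V>(4)[rule_format, OF \<open>V \<in> \<V>\<close>] by (rule bexE)
      moreover have "\<forall>y\<in>W. h y \<notin> W"
        using calculation that(2) by auto
      ultimately show ?thesis
        using that(3) by (meson subsetD)
    qed
    have opV: "openin X V" if "V \<in> \<V>" for V
      using \<V>(1) that by simp
    show ?thesis
      using odd_functions_of_locally_finite_cover[OF pc reg inv opV \<V>(2,3) Cm(2) free] by blast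
  qed
  then obtain g :: "nat \<Rightarrow> nat \<Rightarrow> 'a \<Rightarrow> real" where
    g: "\<And>m k. odd_function X h (g m k)" "\<And>m x. x \<in> C m \<Longrightarrow> \<exists>k. g m k x \<noteq> 0"
    by metis
  show thesis
  proof
    show "odd_function X h (case prod_decode k of (m, j) \<Rightarrow> g m j)" for k
      using g(1) by (simp split: prod.split)
    show "\<exists>k. (case prod_decode k of (m, j) \<Rightarrow> g m j) x \<noteq> 0" if "x \<in> topspace X" "h x \<noteq> x" for x
    proof -
      have "x \<in> \<Union>(range C)"
        using that CU by simp
      then obtain m j where "g m j x \<noteq> 0"
        using g(2) by blast
      then have "(case prod_decode (prod_encode (m, j)) of (m, j) \<Rightarrow> g m j) x \<noteq> 0"
        by simp
      then show ?thesis by blast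
    qed
  qed
qed

section \<open>Bounding the number of odd functions by the dimension\<close>

lemma covering_dim_leE:
  assumes "covering_dim_le X n" "finite \<U>" "\<And>U. U \<in> \<U> \<Longrightarrow> openin X U" "topspace X \<subseteq> \<Union>\<U>"
  obtains \<V> where "finite \<V>" "\<forall>V\<in>\<V>. openin X V" "\<Union>\<V> = topspace X"
    "\<forall>V\<in>\<V>. \<exists>U\<in>\<U>. V \<subseteq> U" "\<forall>x\<in>topspace X. card {V\<in>\<V>. x \<in> V} \<le> n + 1"
proof -
  have "\<Union>\<U> = topspace X"
    using assms(3,4) openin_subset by (metis Sup_least subset_antisym)
  then have "\<exists>\<V>. finite \<V> \<and> (\<forall>V\<in>\<V>. openin X V) \<and> \<Union>\<V> = topspace X \<and>
      (\<forall>V\<in>\<V>. \<exists>U\<in>\<U>. V \<subseteq> U) \<and> (\<forall>x\<in>topspace X. card {V\<in>\<V>. x \<in> V} \<le> n + 1)"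
    using assms(1-3) unfolding covering_dim_le_def by simp
  then show thesis
    using that by (elim exE conjE)
qed

text \<open>A set on which some \<open>g k\<close> has a strict constant sign is moved off itself by
  \<open>h\<close>, because \<open>g k\<close> is odd. Finitely many such sets cover
  \<open>L\<close>, so the dimension yields a refinement with at most \<open>n + 1\<close> members
  at each point. Counting those at \<open>x\<close> and those at \<open>h x\<close> gives the bound,
  from which \<open>M\<close> has disappeared.\<close>

lemma covering_dim_odd_functions:
  fixes g :: "nat \<Rightarrow> 'a \<Rightarrow> real"
  assumes pc: "paracompact_space X" and reg: "regular_space X" and inv: "involution X h"
    and dim: "covering_dim_le X n"
    and odd: "\<And>k. odd_function X h (g k)"
    and L: "closedin X L" and nz: "\<And>x. x \<in> L \<Longrightarrow> \<exists>k<M. g k x \<noteq> 0"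
  shows "\<exists>g' :: nat \<Rightarrow> 'a \<Rightarrow> real. (\<forall>k. odd_function X h (g' k)) \<and>
           (\<forall>x\<in>L. \<exists>k < 2 * (n + 1). g' k x \<noteq> 0)"
proof -
  define P where "P k = {x\<in>topspace X. g k x > 0}" for k
  define Q where "Q k = {x\<in>topspace X. g k x < 0}" for k
  let ?\<C> = "insert (topspace X - L) (P ` {..<M} \<union> Q ` {..<M})"
  have cont: "continuous_map X euclideanreal (g k)" for k
    using odd by (simp add: odd_function_def)
  have "openin X (P k)" for k
    using openin_continuous_map_preimage[OF cont[of k], of "{0<..}"] by (simp add: P_def)
  moreover have "openin X (Q k)" for k
    using openin_continuous_map_preimage[OF cont[of k], of "{..<0}"] by (simp add: Q_def)
  ultimately have op: "openin X W" if "W \<in> ?\<C>" for W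
    using L that by auto
  have cov: "topspace X \<subseteq> \<Union>?\<C>"
  proof
    fix x assume x: "x \<in> topspace X"
    show "x \<in> \<Union>?\<C>"
    proof (cases "x \<in> L")
      case True
      then obtain k where "k < M" "g k x \<noteq> 0"
        using nz by blast
      then have "x \<in> P k \<or> x \<in> Q k"
        using x by (auto simp: P_def Q_def)
      then show ?thesis
        using \<open>k < M\<close> by blast
    qed (use x in blast)
  qed
  have fin: "finite ?\<C>"
    by simp
  obtain \<V> where \<V>: "finite \<V>" "\<forall>V\<in>\<V>. openin X V" "\<Union>\<V> = topspace X"
      "\<forall>V\<in>\<V>. \<exists>W\<in>?\<C>. V \<subseteq> W" and ord: "\<forall>x\<in>topspace X. card {V\<in>\<V>. x \<in> V} \<le> n + 1"
    by (rule covering_dim_leE[OF dim fin op cov])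
  have lf: "locally_finite_in X \<V>"
    using \<V>(1,3) by (simp add: finite_imp_locally_finite_in)
  have free: "h x \<notin> V" if V: "V \<in> \<V>" "V \<inter> L \<noteq> {}" "x \<in> V" for V x
  proof -
    have x: "x \<in> topspace X"
      using V \<V>(3) by blast
    obtain W where W: "W \<in> ?\<C>" "V \<subseteq> W"
      using \<V>(4) V(1) by metis
    then obtain k where "W = P k \<or> W = Q k"
      using V(2) by blast
    moreover have "g k (h x) = - g k x"
      using odd x by (simp add: odd_function_def)
    moreover have "x \<in> W" "h x \<in> W" if "h x \<in> V"
      using W(2) V(3) that by auto
    ultimately show ?thesis
      by (auto simp: P_def Q_def)
  qed
  have L': "L \<subseteq> topspace X"
    using L closedin_subset by blast
  have opV: "openin X V" if "V \<in> \<V>" for V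
    using \<V>(2) that by simp
  obtain g' :: "nat \<Rightarrow> 'a \<Rightarrow> real" where g': "\<And>k. odd_function X h (g' k)"
    and g'nz: "\<And>x. x \<in> L \<Longrightarrow> \<exists>k < card {V\<in>\<V>. x \<in> V} + card {V\<in>\<V>. h x \<in> V}. g' k x \<noteq> 0"
    using odd_functions_of_locally_finite_cover[OF pc reg inv opV \<V>(3) lf L' free] by blast
  show ?thesis
  proof (intro exI[of _ g'] conjI allI ballI g')
    fix x assume x: "x \<in> L"
    then have xt: "x \<in> topspace X" "h x \<in> topspace X"
      using L' involution_in_topspace[OF inv] by auto
    have "card {V\<in>\<V>. x \<in> V} + card {V\<in>\<V>. h x \<in> V} \<le> (n + 1) + (n + 1)"
      by (rule add_mono[OF ord[rule_format, OF xt(1)] ord[rule_format, OF xt(2)]])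
    then have "card {V\<in>\<V>. x \<in> V} + card {V\<in>\<V>. h x \<in> V} \<le> 2 * (n + 1)"
      by simp
    then show "\<exists>k < 2 * (n + 1). g' k x \<noteq> 0"
      using g'nz[OF x] by (meson order_less_le_trans)
  qed
qed

section \<open>Zero sets of odd functions in F-spaces\<close>

text \<open>A function \<open>f\<close> separating \<open>u > 0\<close> from \<open>u < 0\<close>
  takes both values 0 and 1 on every pair \<open>y\<close>, \<open>h y\<close> with
  \<open>u y \<noteq> 0\<close>. For \<open>y\<close> close to the fixed point \<open>x\<close>,
  both values are close to \<open>f x\<close>, which differs from 0 or from 1.\<close>

lemma F_space_odd_zero_set_nhd:
  assumes F: "F_space X" and inv: "involution X h" and odd: "odd_function X h u"
    and x: "x \<in> topspace X" "h x = x"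
  shows "\<exists>N. openin X N \<and> x \<in> N \<and> (\<forall>y\<in>N. u y = 0)"
proof -
  have hX: "continuous_map X X h"
    using inv by (auto simp: involution_def)
  have u: "continuous_map X euclideanreal u" and uh: "\<And>y. y \<in> topspace X \<Longrightarrow> u (h y) = - u y"
    using odd by (auto simp: odd_function_def)
  define P where "P = {y\<in>topspace X. u y > 0}"
  define Q where "Q = {y\<in>topspace X. u y < 0}"
  have "cozero_in X P"
    unfolding cozero_in_def P_def
    by (rule exI[of _ "\<lambda>y. max 0 (u y)"])
       (use u in \<open>auto intro!: continuous_map_real_max\<close>)
  moreover have "cozero_in X Q"
    unfolding cozero_in_def Q_def
    by (rule exI[of _ "\<lambda>y. min 0 (u y)"])
       (use u in \<open>auto intro!: continuous_map_real_min\<close>)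
  moreover have "P \<inter> Q = {}"
    by (auto simp: P_def Q_def)
  ultimately have "completely_separated_in X P Q"
    using F by (simp add: F_space_def)
  then obtain f :: "'a \<Rightarrow> real" where "continuous_map X (top_of_set {0..1}) f"
    and f01: "f ` P \<subseteq> {0}" "f ` Q \<subseteq> {1}"
    unfolding completely_separated_in_def by blast
  then have f: "continuous_map X euclideanreal f"
    using continuous_map_into_fulltopology by blast
  have nhd: ?thesis if S: "open S" "f x \<in> S" and not01: "0 \<notin> S \<or> 1 \<notin> S" for S
  proof -
    define N0 where "N0 = {y\<in>topspace X. f y \<in> S}"
    \<comment> \<open>Both \<open>y\<close> and \<open>h y\<close> have to lie in \<open>N0\<close>;
      the point \<open>x\<close> qualifies because \<open>h x = x\<close>.\<close>
    define N where "N = N0 \<inter> {y\<in>topspace X. h y \<in> N0}"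
    have N0: "openin X N0"
      unfolding N0_def using openin_continuous_map_preimage[OF f] S by simp
    show ?thesis
    proof (intro exI conjI ballI)
      show "openin X N"
        unfolding N_def using N0 openin_continuous_map_preimage[OF hX N0] by blast
      show "x \<in> N"
        using x S by (simp add: N_def N0_def)
      fix y assume y: "y \<in> N"
      show "u y = 0"
      proof (rule ccontr)
        assume "u y \<noteq> 0"
        then have "y \<in> P \<and> h y \<in> Q \<or> y \<in> Q \<and> h y \<in> P"
          using y uh[of y] by (auto simp: N_def N0_def P_def Q_def)
        then have "f y = 0 \<and> f (h y) = 1 \<or> f y = 1 \<and> f (h y) = 0"
          using f01 by blast
        then show False
          using y not01 by (auto simp: N_def N0_def)
      qed
    qed
  qed
  show ?thesis
    using nhd[of "{0<..}"] nhd[of "{..<1}"] by (cases "f x > 0") auto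
qed

lemma F_space_fixed_points_open:
  assumes F: "F_space X" and inv: "involution X h" and fin: "finite \<G>"
    and odd: "\<And>u. u \<in> \<G> \<Longrightarrow> odd_function X h u"
    and nz: "\<And>x. \<lbrakk>x \<in> topspace X; h x \<noteq> x\<rbrakk> \<Longrightarrow> \<exists>u\<in>\<G>. u x \<noteq> 0"
  shows "openin X {x\<in>topspace X. h x = x}"
proof (subst openin_subopen, intro ballI)
  fix x assume "x \<in> {x\<in>topspace X. h x = x}"
  then have x: "x \<in> topspace X" "h x = x"
    by auto
  have "\<exists>N. openin X N \<and> x \<in> N \<and> (\<forall>y\<in>N. u y = 0)" if "u \<in> \<G>" for u
    by (rule F_space_odd_zero_set_nhd[OF F inv odd[OF that] x])
  then obtain N where N: "\<And>u. u \<in> \<G> \<Longrightarrow> openin X (N u) \<and> x \<in> N u \<and> (\<forall>y\<in>N u. u y = 0)"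
    by metis
  \<comment> \<open>Intersecting with the whole space covers the case of an empty \<G>, where the
    intersection over the family would be \<open>UNIV\<close>.\<close>
  have "openin X (topspace X \<inter> \<Inter>(N ` \<G>))"
    using fin N by (cases "\<G> = {}") (auto intro!: openin_Int openin_INT)
  moreover have "topspace X \<inter> \<Inter>(N ` \<G>) \<subseteq> {x\<in>topspace X. h x = x}"
    using N nz by blast
  ultimately show "\<exists>T. openin X T \<and> x \<in> T \<and> T \<subseteq> {x\<in>topspace X. h x = x}"
    using x N by blast
qed

section \<open>Gluing odd functions over layers\<close>

text \<open>The number of functions needed is the same on every layer, but the functions themselves
  vary. Cutting them off to their layers and summing over layers of one parity gives
  \<open>u p j\<close>, where \<open>p < 2\<close> is the parity and \<open>j < 2 * (n + 1)\<close>
  comes from the dimension.\<close>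

lemma finite_odd_functions:
  assumes pc: "paracompact_space X" and reg: "regular_space X" and haus: "Hausdorff_space X"
    and inv: "involution X h"
    and dim: "covering_dim_le X n"
    and gdelta: "gdelta_in X {x\<in>topspace X. h x = x}"
  shows "\<exists>\<G>. finite \<G> \<and> (\<forall>u\<in>\<G>. odd_function X h u) \<and>
           (\<forall>x\<in>topspace X. h x \<noteq> x \<longrightarrow> (\<exists>u\<in>\<G>. u x \<noteq> 0))"
proof -
  obtain g0 :: "nat \<Rightarrow> 'a \<Rightarrow> real" where g0: "\<And>k. odd_function X h (g0 k)"
    and g0nz: "\<And>x. \<lbrakk>x \<in> topspace X; h x \<noteq> x\<rbrakk> \<Longrightarrow> \<exists>k. g0 k x \<noteq> 0"
    using countable_odd_functions[OF pc reg haus inv gdelta] by blast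
  \<comment> \<open>Clamping keeps oddness and zeros, and it makes the series with geometric weights
    converge uniformly.\<close>
  define g where "g k x = max (- 1) (min 1 (g0 k x))" for k x
  have g: "odd_function X h (g k)" for k
    unfolding g_def by (rule odd_function_clamp[OF g0])
  have gnz: "\<exists>k. g k x \<noteq> 0" if "x \<in> topspace X" "h x \<noteq> x" for x
    using g0nz[OF that] by (auto simp: g_def max_def min_def)
  define a where "a k x = (1/2) ^ k * \<bar>g k x\<bar>" for k x
  have a_nonneg: "0 \<le> a k x" for k x
    by (simp add: a_def)
  have a_le: "a k x \<le> (1/2) ^ k" for k x
    unfolding a_def by (intro mult_left_le) (auto simp: g_def)
  have summ_a: "summable (\<lambda>k. a k x)" for x
    by (rule summable_comparison_test'[of "\<lambda>k. (1/2) ^ k" 0])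
       (use a_nonneg a_le in \<open>auto simp: summable_geometric\<close>)
  \<comment> \<open>\<open>s\<close> is continuous, invariant under \<open>h\<close> and positive
    off the fixed points. By the invariance, multiplying by a function of \<open>s\<close> preserves
    oddness.\<close>
  define s where "s x = (\<Sum>k. a k x)" for x
  have cont_s: "continuous_map X euclideanreal s"
    unfolding s_def
  proof (rule continuous_map_suminf_geometric)
    show "continuous_map X euclideanreal (a k)" for k
      using g unfolding a_def odd_function_def
      by (intro continuous_map_real_mult_left continuous_map_real_abs) auto
    show "\<bar>a k x\<bar> \<le> (1/2) ^ k" for k x
      using a_nonneg[of k x] a_le[of k x] by simp
  qed
  have s_h: "s (h x) = s x" if "x \<in> topspace X" for x
    using g that by (simp add: s_def a_def odd_function_def)
  have s_pos: "s x > 0" if x: "x \<in> topspace X" "h x \<noteq> x" for x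
  proof -
    obtain k where "g k x \<noteq> 0"
      using gnz[OF x] by blast
    then have "0 < a k x"
      by (simp add: a_def)
    then show ?thesis
      unfolding s_def using summ_a a_nonneg by (intro suminf_pos2) auto
  qed
  \<comment> \<open>The threshold is the lower edge of the layer of \<open>b m\<close> below, so
    that this layer lies inside \<open>L m\<close>.\<close>
  define L where "L m = {x\<in>topspace X. s x \<in> {1 / (real m + 2)..}}" for m
  have L_closed: "closedin X (L m)" for m
    unfolding L_def by (rule closedin_continuous_map_preimage[OF cont_s]) simp
  have "\<exists>M. \<forall>x\<in>L m. \<exists>k<M. g k x \<noteq> 0" for m
  proof -
    \<comment> \<open>The terms of \<open>s\<close> from index \<open>M\<close> on sum to at most
      \<open>2 * (1/2) ^ M\<close>, which this choice puts below the threshold. Hence the first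
      \<open>M\<close> functions cannot all vanish at a point of \<open>L m\<close>.\<close>
    obtain M where M: "(1/2) ^ M < 1 / (2 * (real m + 2))"
      using real_arch_pow_inv[of "1 / (2 * (real m + 2))" "1/2"] by auto
    have "\<exists>k<M. g k x \<noteq> 0" if x: "x \<in> L m" for x
    proof (rule ccontr)
      assume "\<not> (\<exists>k<M. g k x \<noteq> 0)"
      then have "(\<Sum>k<M. a k x) = 0"
        by (simp add: a_def)
      then have "s x = (\<Sum>k. a (k + M) x)"
        using suminf_split_initial_segment[OF summ_a, of x M] by (simp add: s_def)
      also have "\<dots> \<le> (\<Sum>k. (1/2) ^ (k + M))"
        using a_le summable_ignore_initial_segment[OF summ_a]
        by (intro suminf_le summable_ignore_initial_segment[OF summable_geometric]) auto
      also have "\<dots> = (\<Sum>k. (1/2) ^ M * (1/2) ^ k)"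
        by (simp add: power_add mult.commute)
      also have "\<dots> = (1/2) ^ M * 2"
        by (subst suminf_mult) (auto simp: suminf_geometric summable_geometric)
      also have "\<dots> < 1 / (real m + 2)"
        using M by (simp add: field_simps)
      finally show False
        using x by (simp add: L_def)
    qed
    then show ?thesis by blast
  qed
  then obtain M where M: "\<And>m x. x \<in> L m \<Longrightarrow> \<exists>k<M m. g k x \<noteq> 0"
    by metis
  have "\<exists>G :: nat \<Rightarrow> 'a \<Rightarrow> real. (\<forall>k. odd_function X h (G k)) \<and>
      (\<forall>x\<in>L m. \<exists>k < 2 * (n + 1). G k x \<noteq> 0)" for m
    by (rule covering_dim_odd_functions[OF pc reg inv dim g L_closed M])
  then obtain G :: "nat \<Rightarrow> nat \<Rightarrow> 'a \<Rightarrow> real" where G: "\<And>m k. odd_function X h (G m k)"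
    and Gnz: "\<And>m x. x \<in> L m \<Longrightarrow> \<exists>k < 2 * (n + 1). G m k x \<noteq> 0"
    by metis
  define E where "E m k x = max (- 1) (min 1 (G m k x))" for m k x
  have E: "odd_function X h (E m k)" for m k
    unfolding E_def by (rule odd_function_clamp[OF G])
  have Enz: "E m k x \<noteq> 0" if "G m k x \<noteq> 0" for m k x
    using that by (auto simp: E_def max_def min_def)
  \<comment> \<open>\<^term>\<open>b m\<close> is supported on the layer \<^prop>\<open>1 / (real m + 2) < s x \<and> real m * s x < 1\<close>;
    layers of equal parity are disjoint, so the bounds on all layers combine at the cost of a factor 2.\<close>
  define b where "b m x = min 1 (max 0 (((real m + 2) * s x - 1) * (1 - real m * s x)))" for m x
  have cont_b: "continuous_map X euclideanreal (b m)" for m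
    unfolding b_def using cont_s
    by (intro continuous_map_real_min continuous_map_real_max continuous_map_real_mult
        continuous_map_diff) auto
  have b_disj: "m = m'" if "b m x \<noteq> 0" "b m' x \<noteq> 0" "even (m + m')" "s x > 0" for m m' x
  proof -
    have *: "(real m + 2) * s x > 1 \<and> real m * s x < 1" if "b m x \<noteq> 0" for m
    proof -
      have "max 0 (((real m + 2) * s x - 1) * (1 - real m * s x)) \<noteq> 0"
        using that by (metis b_def min.absorb2 zero_le_one)
      then have "((real m + 2) * s x - 1) * (1 - real m * s x) > 0"
        by linarith
      \<comment> \<open>This excludes that both factors are negative, which would mean
        \<open>(real m + 2) * s x < 1 < real m * s x\<close>.\<close>
      moreover have "(real m + 2) * s x > real m * s x"
        using \<open>s x > 0\<close> by (simp add: distrib_right)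
      ultimately show ?thesis
        by (auto simp: zero_less_mult_iff)
    qed
    have less: False if "m + 2 \<le> m'" "b m x \<noteq> 0" "b m' x \<noteq> 0" for m m'
    proof -
      have "(real m + 2) * s x \<le> real m' * s x"
        using that(1) \<open>s x > 0\<close> by (intro mult_right_mono) auto
      then show False
        using *[OF that(2)] *[OF that(3)] by linarith
    qed
    \<comment> \<open>Distinct indices of equal parity differ by at least 2; the lower edge of the
      layer with the smaller index is then no lower than the upper edge of the other.\<close>
    have "m = m' \<or> m + 2 \<le> m' \<or> m' + 2 \<le> m"
      using \<open>even (m + m')\<close> by presburger
    then show ?thesis
      using less that(1,2) by blast
  qed
  \<comment> \<open>The layer is \<open>2 * q + p\<close> with parity \<open>p\<close>. The weights
    make the sum over \<open>q\<close> continuous; where \<open>s x > 0\<close>, at most one term is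
    nonzero, so nothing can cancel.\<close>
  define t where "t p j q x = (1/2) ^ q * (b (2 * q + p) x * E (2 * q + p) j x)" for p j q x
  define u where "u p j x = (\<Sum>q. t p j q x)" for p j x
  have t_le: "\<bar>t p j q x\<bar> \<le> (1/2) ^ q" for p j q x
  proof -
    have "\<bar>b (2 * q + p) x\<bar> * \<bar>E (2 * q + p) j x\<bar> \<le> 1 * 1"
      by (intro mult_mono) (auto simp: b_def E_def)
    then show ?thesis
      unfolding t_def abs_mult by (simp add: mult_left_le)
  qed
  have summ_t: "summable (\<lambda>q. t p j q x)" for p j x
    by (rule summable_comparison_test'[of "\<lambda>k. (1/2) ^ k" 0])
       (use t_le in \<open>auto simp: summable_geometric\<close>)
  have u: "odd_function X h (u p j)" for p j
    unfolding odd_function_def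
  proof (intro conjI ballI)
    show "continuous_map X euclideanreal (u p j)"
      unfolding u_def
    proof (rule continuous_map_suminf_geometric)
      show "continuous_map X euclideanreal (t p j q)" for q
        using E cont_b unfolding t_def odd_function_def
        by (intro continuous_map_real_mult_left continuous_map_real_mult) auto
      show "\<bar>t p j q x\<bar> \<le> (1/2) ^ q" for q x
        by (rule t_le)
    qed
    fix x assume x: "x \<in> topspace X"
    have "t p j q (h x) = - t p j q x" for q
      using E x by (simp add: t_def b_def s_h odd_function_def)
    then show "u p j (h x) = - u p j x"
      using suminf_minus[OF summ_t] by (simp add: u_def)
  qed
  have "\<exists>p<2. \<exists>j<2 * (n + 1). u p j x \<noteq> 0" if x: "x \<in> topspace X" "h x \<noteq> x" for x
  proof -
    have sx: "s x > 0"
      by (rule s_pos[OF x])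
    \<comment> \<open>This is the integer with \<open>m < 1 / s x \<le> m + 1\<close>. The ceiling
      is at least 1, so \<open>nat\<close> truncates nothing, and \<open>x\<close> lies strictly
      inside layer \<open>m\<close>.\<close>
    define m where "m = nat (\<lceil>1 / s x\<rceil> - 1)"
    have "\<lceil>1 / s x\<rceil> \<ge> 1"
      using sx by (simp add: one_le_ceiling)
    then have "real m < 1 / s x" "1 / s x < real m + 2"
      unfolding m_def using ceiling_correct[of "1 / s x"] by linarith+
    then have m: "real m * s x < 1" "1 < (real m + 2) * s x"
      using sx by (auto simp: field_simps)
    then have bm: "b m x \<noteq> 0"
      by (auto simp: b_def min_def max_def)
    have "x \<in> L m"
      using x m sx by (simp add: L_def field_simps)
    then obtain j where j: "j < 2 * (n + 1)" "G m j x \<noteq> 0"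
      using Gnz by blast
    define p where "p = m mod 2"
    define q where "q = m div 2"
    have mpq: "2 * q + p = m"
      by (simp add: p_def q_def)
    have "t p j q' x = 0" if "q' \<notin> {q}" for q'
    proof (rule ccontr)
      assume "t p j q' x \<noteq> 0"
      then have "b (2 * q' + p) x \<noteq> 0"
        by (auto simp: t_def)
      then have "2 * q' + p = m"
        using bm sx mpq by (intro b_disj[of _ x]) auto
      then show False
        using that mpq by simp
    qed
    then have "u p j x = sum (\<lambda>q. t p j q x) {q}"
      unfolding u_def by (intro suminf_finite) auto
    also have "\<dots> \<noteq> 0"
      using bm Enz[OF j(2)] by (simp add: t_def mpq)
    finally have "u p j x \<noteq> 0" .
    moreover have "p < 2"
      by (simp add: p_def)
    ultimately show ?thesis
      using j(1) by blast
  qed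
  then have "\<forall>x\<in>topspace X. h x \<noteq> x \<longrightarrow> (\<exists>v\<in>(\<lambda>(p, j). u p j) ` ({..<2} \<times> {..<2 * (n + 1)}). v x \<noteq> 0)"
    by fastforce
  moreover have "\<forall>v\<in>(\<lambda>(p, j). u p j) ` ({..<2} \<times> {..<2 * (n + 1)}). odd_function X h v"
    using u by auto
  ultimately show ?thesis
    by (intro exI[of _ "(\<lambda>(p, j). u p j) ` ({..<2} \<times> {..<2 * (n + 1)})"]) blast
qed

lemma F_space_involution_fixed_points_open:
  assumes "paracompact_space X" "regular_space X" "Hausdorff_space X" "F_space X"
    and "finite_covering_dim X" "involution X h" "gdelta_in X {x\<in>topspace X. h x = x}"
  shows "openin X {x\<in>topspace X. h x = x}"
proof -
  obtain n where n: "covering_dim_le X n"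
    using assms(5) by (auto simp: finite_covering_dim_def)
  obtain \<G> where "finite \<G>" "\<forall>u\<in>\<G>. odd_function X h u"
      "\<forall>x\<in>topspace X. h x \<noteq> x \<longrightarrow> (\<exists>u\<in>\<G>. u x \<noteq> 0)"
    using finite_odd_functions[OF assms(1-3,6) n assms(7)] by (elim exE conjE)
  then show ?thesis
    using assms(4,6) by (intro F_space_fixed_points_open[of X h \<G>]) auto
qed

section \<open>Inheritance by clopen subspaces\<close>

text \<open>A refining set that contains a point of \<open>H\<close> cannot lie in the complement of
  \<open>H\<close>, so it lies in a member of \<U>. This carries covers of a clopen \<open>H\<close>
  to the whole space and refinements back, for paracompactness and for dimension alike.\<close>

lemma subset_cover_refinement:
  assumes H: "H \<subseteq> topspace X" and \<U>: "\<Union>\<U> = H"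
    and \<V>: "\<Union>\<V> = topspace X" "\<forall>V\<in>\<V>. \<exists>U\<in>insert (topspace X - H) \<U>. V \<subseteq> U"
  shows "\<Union>{V\<in>\<V>. \<exists>U\<in>\<U>. V \<subseteq> U} = H"
proof
  show "\<Union>{V\<in>\<V>. \<exists>U\<in>\<U>. V \<subseteq> U} \<subseteq> H"
    using \<U> by blast
  show "H \<subseteq> \<Union>{V\<in>\<V>. \<exists>U\<in>\<U>. V \<subseteq> U}"
  proof
    fix x assume x: "x \<in> H"
    then obtain V where V: "V \<in> \<V>" "x \<in> V"
      using H \<V>(1) by blast
    obtain U where "U \<in> insert (topspace X - H) \<U>" "V \<subseteq> U"
      using \<V>(2)[rule_format, OF V(1)] by (rule bexE)
    then have "U \<in> \<U>"
      using x V(2) by blast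
    then show "x \<in> \<Union>{V\<in>\<V>. \<exists>U\<in>\<U>. V \<subseteq> U}"
      using V \<open>V \<subseteq> U\<close> by blast
  qed
qed

lemma paracompact_space_clopen_subtopology:
  assumes pc: "paracompact_space X" and op: "openin X H" and clo: "closedin X H"
  shows "paracompact_space (subtopology X H)"
  unfolding paracompact_space_def
proof (intro allI impI, elim conjE)
  have H: "topspace (subtopology X H) = H"
    using openin_subset[OF op] by auto
  fix \<U> assume "\<forall>U\<in>\<U>. openin (subtopology X H) U" and "\<Union>\<U> = topspace (subtopology X H)"
  then have \<U>: "\<And>U. U \<in> \<U> \<Longrightarrow> openin X U" "\<Union>\<U> = H"
    using op H by (simp_all add: openin_open_subtopology)
  have opC: "openin X U" if "U \<in> insert (topspace X - H) \<U>" for U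
    using that \<U>(1) clo by auto
  have cov: "topspace X \<subseteq> \<Union>(insert (topspace X - H) \<U>)"
    using \<U>(2) by auto
  obtain \<V> where \<V>: "\<forall>V\<in>\<V>. openin X V" "\<Union>\<V> = topspace X" "locally_finite_in X \<V>"
      "\<forall>V\<in>\<V>. \<exists>U\<in>insert (topspace X - H) \<U>. V \<subseteq> U"
    by (rule paracompact_spaceE[OF pc opC cov])
  define \<W> where "\<W> = {V\<in>\<V>. \<exists>U\<in>\<U>. V \<subseteq> U}"
  have \<W>H: "\<Union>\<W> = H"
    unfolding \<W>_def by (rule subset_cover_refinement[OF closedin_subset[OF clo] \<U>(2) \<V>(2,4)])
  have "locally_finite_in X \<W>"
    by (rule locally_finite_in_subset[OF \<V>(3)]) (auto simp: \<W>_def)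
  then have "locally_finite_in (subtopology X H) \<W>"
    using \<W>H by (intro locally_finite_in_subtopology) auto
  moreover have "\<forall>V\<in>\<W>. openin (subtopology X H) V"
    using \<V>(1) \<W>H op by (auto simp: openin_open_subtopology \<W>_def)
  moreover have "\<forall>V\<in>\<W>. \<exists>U\<in>\<U>. V \<subseteq> U"
    by (simp add: \<W>_def)
  ultimately show "\<exists>\<V>. (\<forall>V\<in>\<V>. openin (subtopology X H) V) \<and> \<Union>\<V> = topspace (subtopology X H) \<and>
      locally_finite_in (subtopology X H) \<V> \<and> (\<forall>V\<in>\<V>. \<exists>U\<in>\<U>. V \<subseteq> U)"
    using \<W>H H by (intro exI[of _ \<W>]) simp
qed

lemma covering_dim_le_clopen_subtopology:
  assumes dim: "covering_dim_le X n" and op: "openin X H" and clo: "closedin X H"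
  shows "covering_dim_le (subtopology X H) n"
  unfolding covering_dim_le_def
proof (intro allI impI, elim conjE)
  have H: "topspace (subtopology X H) = H"
    using openin_subset[OF op] by auto
  fix \<U> assume "\<forall>U\<in>\<U>. openin (subtopology X H) U" and "\<Union>\<U> = topspace (subtopology X H)"
    and fin: "finite \<U>"
  then have \<U>: "\<And>U. U \<in> \<U> \<Longrightarrow> openin X U" "\<Union>\<U> = H"
    using op H by (simp_all add: openin_open_subtopology)
  have opC: "openin X U" if "U \<in> insert (topspace X - H) \<U>" for U
    using that \<U>(1) clo by auto
  have cov: "topspace X \<subseteq> \<Union>(insert (topspace X - H) \<U>)"
    using \<U>(2) by auto
  have finC: "finite (insert (topspace X - H) \<U>)"
    using fin by simp
  obtain \<V> where \<V>: "finite \<V>" "\<forall>V\<in>\<V>. openin X V" "\<Union>\<V> = topspace X"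
      "\<forall>V\<in>\<V>. \<exists>U\<in>insert (topspace X - H) \<U>. V \<subseteq> U"
    and ord: "\<forall>x\<in>topspace X. card {V\<in>\<V>. x \<in> V} \<le> n + 1"
    by (rule covering_dim_leE[OF dim finC opC cov])
  define \<W> where "\<W> = {V\<in>\<V>. \<exists>U\<in>\<U>. V \<subseteq> U}"
  have \<W>H: "\<Union>\<W> = H"
    unfolding \<W>_def by (rule subset_cover_refinement[OF closedin_subset[OF clo] \<U>(2) \<V>(3,4)])
  have "\<forall>x\<in>H. card {V\<in>\<W>. x \<in> V} \<le> n + 1"
  proof
    fix x assume "x \<in> H"
    then have x: "x \<in> topspace X"
      using closedin_subset[OF clo] by blast
    have "card {V\<in>\<W>. x \<in> V} \<le> card {V\<in>\<V>. x \<in> V}"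
      using \<V>(1) by (intro card_mono) (auto simp: \<W>_def)
    also have "\<dots> \<le> n + 1"
      using ord x by blast
    finally show "card {V\<in>\<W>. x \<in> V} \<le> n + 1" .
  qed
  moreover have "\<forall>V\<in>\<W>. openin (subtopology X H) V"
    using \<V>(2) \<W>H op by (auto simp: openin_open_subtopology \<W>_def)
  moreover have "\<forall>V\<in>\<W>. \<exists>U\<in>\<U>. V \<subseteq> U" "finite \<W>"
    using \<V>(1) by (simp_all add: \<W>_def)
  ultimately show "\<exists>\<V>. finite \<V> \<and> (\<forall>V\<in>\<V>. openin (subtopology X H) V) \<and>
      \<Union>\<V> = topspace (subtopology X H) \<and> (\<forall>V\<in>\<V>. \<exists>U\<in>\<U>. V \<subseteq> U) \<and>
      (\<forall>x\<in>topspace (subtopology X H). card {V\<in>\<V>. x \<in> V} \<le> n + 1)"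
    using \<W>H H by (intro exI[of _ \<W>]) simp
qed

text \<open>Extension by 0 is continuous across a clopen set and leaves the cozero set unchanged.
  Disjoint cozero sets of \<open>H\<close> can therefore be separated in \<open>X\<close>, and the
  separating function restricted to \<open>H\<close>.\<close>

lemma cozero_in_clopen_subtopology:
  assumes op: "openin X H" and clo: "closedin X H" and A: "cozero_in (subtopology X H) A"
  shows "cozero_in X A"
proof -
  have HX: "H \<subseteq> topspace X"
    using openin_subset[OF op] .
  obtain f :: "'a \<Rightarrow> real" where f: "continuous_map (subtopology X H) euclideanreal f"
    and A: "A = {x \<in> topspace (subtopology X H). f x \<noteq> 0}"
    using A unfolding cozero_in_def by (elim exE conjE)
  define f' where "f' x = (if x \<in> H then f x else 0)" for x
  have "continuous_map X euclideanreal f'"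
  proof (rule pasting_lemma[where I = UNIV and T = "\<lambda>i. if i then H else topspace X - H"
        and f = "\<lambda>i. if i then f else (\<lambda>x. 0)"])
    show "openin X (if i then H else topspace X - H)" for i
      using op clo by auto
    show "continuous_map (subtopology X (if i then H else topspace X - H)) euclideanreal
            (if i then f else (\<lambda>x. 0))" for i
      using f by simp
  qed (auto simp: f'_def split: if_splits)
  moreover have "A = {x \<in> topspace X. f' x \<noteq> 0}"
    using HX A by (auto simp: f'_def)
  ultimately show ?thesis
    unfolding cozero_in_def by blast
qed

lemma F_space_clopen_subtopology:
  assumes F: "F_space X" and op: "openin X H" and clo: "closedin X H"
  shows "F_space (subtopology X H)"
  unfolding F_space_def
proof (intro allI impI, elim conjE)
  fix A B assume "cozero_in (subtopology X H) A" "cozero_in (subtopology X H) B" "A \<inter> B = {}"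
  then have "completely_separated_in X A B"
    using F cozero_in_clopen_subtopology[OF op clo] unfolding F_space_def by blast
  then show "completely_separated_in (subtopology X H) A B"
    unfolding completely_separated_in_def using continuous_map_from_subtopology by blast
qed

section \<open>Subgroups of topological groups\<close>

lemma topological_group_subgroup:
  assumes tg: "topological_group G T" and sub: "subgroup H G"
  shows "topological_group (G\<lparr>carrier := H\<rparr>) (subtopology T H)"
proof -
  have G: "group G" and top: "topspace T = carrier G"
    and mul: "continuous_map (prod_topology T T) T (\<lambda>(x, y). x \<otimes>\<^bsub>G\<^esub> y)"
    and inv: "continuous_map T T (\<lambda>x. inv\<^bsub>G\<^esub> x)"
    using tg by (auto simp: topological_group_def)
  interpret G: group G by fact
  interpret H: subgroup H G by fact
  show ?thesis
    unfolding topological_group_def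
  proof (intro conjI)
    show "group (G\<lparr>carrier := H\<rparr>)"
      by (rule H.subgroup_is_group[OF G])
    show "topspace (subtopology T H) = carrier (G\<lparr>carrier := H\<rparr>)"
      using H.subset top by auto
    have "continuous_map (subtopology (prod_topology T T) (H \<times> H)) (subtopology T H)
        (\<lambda>(x, y). x \<otimes>\<^bsub>G\<^esub> y)"
      using continuous_map_from_subtopology[OF mul]
      by (auto simp: continuous_map_in_subtopology)
    then show "continuous_map (prod_topology (subtopology T H) (subtopology T H)) (subtopology T H)
        (\<lambda>(x, y). x \<otimes>\<^bsub>G\<lparr>carrier := H\<rparr>\<^esub> y)"
      by (simp add: subtopology_Times)
    have "continuous_map (subtopology T H) (subtopology T H) (\<lambda>x. inv\<^bsub>G\<^esub> x)"
      using continuous_map_from_subtopology[OF inv]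
      by (auto simp: continuous_map_in_subtopology)
    then show "continuous_map (subtopology T H) (subtopology T H) (\<lambda>x. inv\<^bsub>G\<lparr>carrier := H\<rparr>\<^esub> x)"
      \<comment> \<open>The inverse in the restricted group agrees with the inverse in
        \<open>G\<close> on \<open>H\<close>, which is the whole space here.\<close>
      by (rule continuous_map_eq) (simp add: G.m_inv_consistent[OF sub])
  qed
qed

lemma (in group) centralizer_subgroup:
  assumes "S \<subseteq> carrier G"
  shows "subgroup {x \<in> carrier G. \<forall>s\<in>S. x \<otimes> s = s \<otimes> x} G"
proof (rule subgroupI)
  show "{x \<in> carrier G. \<forall>s\<in>S. x \<otimes> s = s \<otimes> x} \<noteq> {}"
    using assms by (auto intro!: exI[of _ \<one>])
  fix a assume a: "a \<in> {x \<in> carrier G. \<forall>s\<in>S. x \<otimes> s = s \<otimes> x}"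
  have "inv a \<otimes> s = s \<otimes> inv a" if "s \<in> S" for s
  proof -
    have s: "s \<in> carrier G" "a \<in> carrier G" "a \<otimes> s = s \<otimes> a"
      using assms a that by auto
    have "inv a \<otimes> s = inv a \<otimes> (s \<otimes> a) \<otimes> inv a"
      using s(1,2) by (simp add: m_assoc)
    also have "\<dots> = inv a \<otimes> (a \<otimes> s) \<otimes> inv a"
      using s(3) by simp
    also have "\<dots> = s \<otimes> inv a"
      using s(1,2) by (simp flip: m_assoc)
    finally show ?thesis .
  qed
  then show "inv a \<in> {x \<in> carrier G. \<forall>s\<in>S. x \<otimes> s = s \<otimes> x}"
    using a by simp
  fix b assume b: "b \<in> {x \<in> carrier G. \<forall>s\<in>S. x \<otimes> s = s \<otimes> x}"
  have "(a \<otimes> b) \<otimes> s = s \<otimes> (a \<otimes> b)" if "s \<in> S" for s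
  proof -
    have s: "s \<in> carrier G" "a \<in> carrier G" "b \<in> carrier G" "a \<otimes> s = s \<otimes> a" "b \<otimes> s = s \<otimes> b"
      using assms a b that by auto
    then show ?thesis
      by (metis m_assoc)
  qed
  then show "a \<otimes> b \<in> {x \<in> carrier G. \<forall>s\<in>S. x \<otimes> s = s \<otimes> x}"
    using a b by simp
qed auto

text \<open>If \<open>a\<close>, \<open>b\<close> and their product are their own inverses, then
  \<open>a \<otimes> b = inv (a \<otimes> b) = inv b \<otimes> inv a = b \<otimes> a\<close>. So
  \<open>V\<close> is commutative. Working inside its double centralizer avoids computing with words
  in generators.\<close>

lemma (in group) boolean_subgroup_containing:
  assumes V: "V \<subseteq> carrier G" and sq: "\<And>a. a \<in> V \<Longrightarrow> a \<otimes> a = \<one>"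
    and sq2: "\<And>a b. \<lbrakk>a \<in> V; b \<in> V\<rbrakk> \<Longrightarrow> (a \<otimes> b) \<otimes> (a \<otimes> b) = \<one>"
  shows "\<exists>H. subgroup H G \<and> V \<subseteq> H \<and> (\<forall>x\<in>H. x \<otimes> x = \<one>)"
proof -
  define C where "C S = {x \<in> carrier G. \<forall>s\<in>S. x \<otimes> s = s \<otimes> x}" for S
  have invol: "inv a = a" if "a \<in> carrier G" "a \<otimes> a = \<one>" for a
    using that by (intro inv_equality)
  have "a \<otimes> b = b \<otimes> a" if "a \<in> V" "b \<in> V" for a b
  proof -
    have ab: "a \<in> carrier G" "b \<in> carrier G"
      using V that by auto
    have "a \<otimes> b = inv (a \<otimes> b)"
      using invol[of "a \<otimes> b", symmetric] sq2[OF that] ab by simp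
    also have "\<dots> = inv b \<otimes> inv a"
      using ab by (rule inv_mult_group)
    also have "\<dots> = b \<otimes> a"
      using invol[OF ab(1) sq[OF that(1)]] invol[OF ab(2) sq[OF that(2)]] by simp
    finally show ?thesis .
  qed
  then have VC: "V \<subseteq> C V"
    using V by (auto simp: C_def)
  have CC: "subgroup (C (C V)) G"
    unfolding C_def[of "C V"] by (rule centralizer_subgroup) (auto simp: C_def)
  then interpret A: subgroup "C (C V)" G .
  have memC: "x \<in> C S \<longleftrightarrow> x \<in> carrier G \<and> (\<forall>s\<in>S. x \<otimes> s = s \<otimes> x)" for x S
    unfolding C_def by blast
  have VCC: "V \<subseteq> C (C V)"
    using V by (metis memC subsetD subsetI)
  \<comment> \<open>Centralizers reverse inclusions, so \<open>V \<subseteq> C V\<close> gives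
    \<open>C (C V) \<subseteq> C V\<close>. Thus \<open>y\<close> is in \<open>C V\<close>, and
    \<open>x\<close> commutes with all of \<open>C V\<close>.\<close>
  have comm: "x \<otimes> y = y \<otimes> x" if "x \<in> C (C V)" "y \<in> C (C V)" for x y
  proof -
    have "y \<in> C V"
      using that(2) VC by (metis memC subsetD)
    then show ?thesis
      using that(1) by (metis memC)
  qed
  \<comment> \<open>\<^term>\<open>V\<close> is commutative, hence its double centralizer is an abelian subgroup, whose
    involutions form a subgroup.\<close>
  define H where "H = {x \<in> C (C V). x \<otimes> x = \<one>}"
  have HC: "H \<subseteq> C (C V)"
    by (auto simp: H_def)
  have "subgroup H G"
  proof (rule subgroupI)
    show "H \<subseteq> carrier G"
      using HC A.subset by blast
    show "H \<noteq> {}"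
      by (auto simp: H_def intro!: exI[of _ \<one>])
    fix a assume a: "a \<in> H"
    then have ac: "a \<in> carrier G" "a \<otimes> a = \<one>"
      using HC A.subset by (auto simp: H_def)
    show "inv a \<in> H"
      using a invol[OF ac] by simp
    fix b assume b: "b \<in> H"
    then have bc: "b \<in> carrier G" "b \<otimes> b = \<one>"
      using HC A.subset by (auto simp: H_def)
    have "(a \<otimes> b) \<otimes> (a \<otimes> b) = a \<otimes> (b \<otimes> a) \<otimes> b"
      using ac bc by (simp add: m_assoc)
    also have "\<dots> = a \<otimes> (a \<otimes> b) \<otimes> b"
      using comm[OF subsetD[OF HC b] subsetD[OF HC a]] by (rule arg_cong)
    also have "\<dots> = (a \<otimes> a) \<otimes> (b \<otimes> b)"
      using ac(1) bc(1) by (simp add: m_assoc)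
    finally have "(a \<otimes> b) \<otimes> (a \<otimes> b) = \<one>"
      using ac bc by simp
    then show "a \<otimes> b \<in> H"
      using a b by (simp add: H_def)
  qed
  moreover have "V \<subseteq> H"
    using VCC sq by (auto simp: H_def)
  ultimately show ?thesis
    by (auto simp: H_def)
qed

lemma topological_group_left_translation:
  assumes "topological_group G T" "a \<in> carrier G"
  shows "continuous_map T T (\<lambda>x. a \<otimes>\<^bsub>G\<^esub> x)"
proof -
  have "continuous_map T (prod_topology T T) (\<lambda>x. (a, x))"
    using assms by (simp add: continuous_map_pairwise o_def topological_group_def)
  moreover have "continuous_map (prod_topology T T) T (\<lambda>(x, y). x \<otimes>\<^bsub>G\<^esub> y)"
    using assms(1) by (simp add: topological_group_def)
  ultimately show ?thesis
    using continuous_map_compose[of T "prod_topology T T" "\<lambda>x. (a, x)" T "\<lambda>(x, y). x \<otimes>\<^bsub>G\<^esub> y"]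
    by (simp add: o_def)
qed

lemma topological_group_square:
  assumes "topological_group G T"
  shows "continuous_map T T (\<lambda>x. x \<otimes>\<^bsub>G\<^esub> x)"
proof -
  have "continuous_map T (prod_topology T T) (\<lambda>x. (x, x))"
    by (simp add: continuous_map_pairwise o_def)
  moreover have "continuous_map (prod_topology T T) T (\<lambda>(x, y). x \<otimes>\<^bsub>G\<^esub> y)"
    using assms by (simp add: topological_group_def)
  ultimately show ?thesis
    using continuous_map_compose[of T "prod_topology T T" "\<lambda>x. (x, x)" T "\<lambda>(x, y). x \<otimes>\<^bsub>G\<^esub> y"]
    by (simp add: o_def)
qed

text \<open>\<open>H\<close> is the union of the translates of \<open>V\<close> by its elements.
  Each translate is written as a preimage under left translation by the inverse, so continuity
  suffices.\<close>

lemma topological_group_subgroup_open: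
  assumes tg: "topological_group G T" and sub: "subgroup H G"
    and V: "openin T V" "\<one>\<^bsub>G\<^esub> \<in> V" "V \<subseteq> H"
  shows "openin T H"
proof (subst openin_subopen, intro ballI)
  have G: "group G" and top: "topspace T = carrier G"
    using tg by (auto simp: topological_group_def)
  interpret G: group G by fact
  interpret H: subgroup H G by fact
  fix x assume x: "x \<in> H"
  define N where "N = {y\<in>topspace T. inv\<^bsub>G\<^esub> x \<otimes>\<^bsub>G\<^esub> y \<in> V}"
  have "openin T N"
    unfolding N_def using x topological_group_left_translation[OF tg, of "inv\<^bsub>G\<^esub> x"] V(1)
    by (intro openin_continuous_map_preimage) auto
  moreover have "x \<in> N"
    using x V(2) top by (simp add: N_def)
  moreover have "N \<subseteq> H"
  proof
    fix y assume y: "y \<in> N"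
    then have "y \<in> carrier G" "inv\<^bsub>G\<^esub> x \<otimes>\<^bsub>G\<^esub> y \<in> H"
      using V(3) top by (auto simp: N_def)
    then have "x \<otimes>\<^bsub>G\<^esub> (inv\<^bsub>G\<^esub> x \<otimes>\<^bsub>G\<^esub> y) \<in> H"
      using x by blast
    then show "y \<in> H"
      using x \<open>y \<in> carrier G\<close> by (simp flip: G.m_assoc)
  qed
  ultimately show "\<exists>N. openin T N \<and> x \<in> N \<and> N \<subseteq> H"
    by blast
qed

text \<open>The complement is a union of left cosets of \<open>H\<close>, each open as a preimage of
  \<open>H\<close> under a left translation.\<close>

lemma topological_group_open_subgroup_closed:
  assumes tg: "topological_group G T" and sub: "subgroup H G" and op: "openin T H"
  shows "closedin T H"
proof -
  have G: "group G" and top: "topspace T = carrier G"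
    using tg by (auto simp: topological_group_def)
  interpret G: group G by fact
  interpret H: subgroup H G by fact
  have "openin T (topspace T - H)"
  proof (subst openin_subopen, intro ballI)
    fix x assume "x \<in> topspace T - H"
    then have x: "x \<in> carrier G" "x \<notin> H"
      using top by auto
    define N where "N = {y\<in>topspace T. inv\<^bsub>G\<^esub> x \<otimes>\<^bsub>G\<^esub> y \<in> H}"
    have "openin T N"
      unfolding N_def using x topological_group_left_translation[OF tg, of "inv\<^bsub>G\<^esub> x"] op
      by (intro openin_continuous_map_preimage) auto
    moreover have "x \<in> N"
      using x top by (simp add: N_def)
    moreover have "N \<subseteq> topspace T - H"
    proof
      fix y assume y: "y \<in> N"
      then have y': "y \<in> carrier G" "inv\<^bsub>G\<^esub> x \<otimes>\<^bsub>G\<^esub> y \<in> H"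
        using top by (auto simp: N_def)
      have "y \<notin> H"
      proof
        assume "y \<in> H"
        then have "y \<otimes>\<^bsub>G\<^esub> inv\<^bsub>G\<^esub> (inv\<^bsub>G\<^esub> x \<otimes>\<^bsub>G\<^esub> y) \<in> H"
          using y'(2) by blast
        also have "y \<otimes>\<^bsub>G\<^esub> inv\<^bsub>G\<^esub> (inv\<^bsub>G\<^esub> x \<otimes>\<^bsub>G\<^esub> y) = x"
          using x(1) y'(1) by (simp add: G.inv_mult_group flip: G.m_assoc)
        finally show False
          using x(2) by simp
      qed
      then show "y \<in> topspace T - H"
        using y by (simp add: N_def)
    qed
    ultimately show "\<exists>N. openin T N \<and> x \<in> N \<and> N \<subseteq> topspace T - H"
      by blast
  qed
  then show ?thesis
    using openin_subset[OF op] by (simp add: closedin_def)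
qed

section \<open>Inversion and involutions near the identity\<close>

lemma gdelta_in_continuous_map_preimage:
  assumes f: "continuous_map X Y f" and S: "gdelta_in Y S"
  shows "gdelta_in X {x\<in>topspace X. f x \<in> S}"
proof -
  obtain C where C: "(\<forall>n. openin Y (C n)) \<and> (\<forall>n. C (Suc n) \<subseteq> C n) \<and> \<Inter>(range C) = S"
    using S unfolding gdelta_in_descending ..
  have "gdelta_in X (\<Inter>(range (\<lambda>n::nat. {x\<in>topspace X. f x \<in> C n})))"
    using C openin_continuous_map_preimage[OF f]
    by (intro gdelta_in_Inter) (auto intro!: open_imp_gdelta_in)
  moreover have "\<Inter>(range (\<lambda>n::nat. {x\<in>topspace X. f x \<in> C n})) = {x\<in>topspace X. f x \<in> S}"
    using C by auto
  ultimately show ?thesis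
    by simp
qed

theorem theorem1:
  fixes G :: "('a, 'b) monoid_scheme" and T :: "'a topology"
  assumes "topological_group G T"
    and "Hausdorff_space T" and "completely_regular_space T"
    and "paracompact_space T"
    and "F_space T"
    and "finite_covering_dim T"
    and "countable_pseudocharacter G T"
  shows "\<exists>H. subgroup H G \<and> openin T H \<and> (\<forall>x\<in>H. x \<otimes>\<^bsub>G\<^esub> x = \<one>\<^bsub>G\<^esub>) \<and>
             topological_group (G\<lparr>carrier := H\<rparr>) (subtopology T H) \<and>
             Hausdorff_space (subtopology T H) \<and> completely_regular_space (subtopology T H) \<and>
             paracompact_space (subtopology T H) \<and>
             F_space (subtopology T H) \<and>
             finite_covering_dim (subtopology T H) \<and>
             countable_pseudocharacter (G\<lparr>carrier := H\<rparr>) (subtopology T H)"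
proof -
  have G: "group G" and top: "topspace T = carrier G"
    and mul: "continuous_map (prod_topology T T) T (\<lambda>(x, y). x \<otimes>\<^bsub>G\<^esub> y)"
    and cinv: "continuous_map T T (\<lambda>x. inv\<^bsub>G\<^esub> x)"
    using assms(1) by (auto simp: topological_group_def)
  interpret G: group G by fact
  define F where "F = {x\<in>topspace T. inv\<^bsub>G\<^esub> x = x}"
  \<comment> \<open>As the preimage of the identity under squaring, \<open>F\<close> is a G-delta
    set by the countable pseudocharacter; as the fixed-point set of inversion, it is then
    open.\<close>
  have F: "F = {x\<in>topspace T. x \<otimes>\<^bsub>G\<^esub> x \<in> {\<one>\<^bsub>G\<^esub>}}"
    unfolding F_def top using G.inv_equality G.l_inv by fastforce
  have "involution T (\<lambda>x. inv\<^bsub>G\<^esub> x)"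
    using cinv top by (simp add: involution_def)
  moreover have "gdelta_in T F"
    unfolding F using assms(7) topological_group_square[OF assms(1)]
    by (intro gdelta_in_continuous_map_preimage) (auto simp: countable_pseudocharacter_def)
  ultimately have opF: "openin T F"
    unfolding F_def using assms(2,4,5,6) completely_regular_imp_regular_space[OF assms(3)]
    by (intro F_space_involution_fixed_points_open) auto
  define P where "P = {z\<in>topspace (prod_topology T T). (case z of (x, y) \<Rightarrow> x \<otimes>\<^bsub>G\<^esub> y) \<in> F}"
  have "openin (prod_topology T T) P"
    unfolding P_def by (rule openin_continuous_map_preimage[OF mul opF])
  moreover have "(\<one>\<^bsub>G\<^esub>, \<one>\<^bsub>G\<^esub>) \<in> P"
    by (simp add: P_def F top)
  ultimately obtain U W where UW: "openin T U" "openin T W" "\<one>\<^bsub>G\<^esub> \<in> U" "\<one>\<^bsub>G\<^esub> \<in> W" "U \<times> W \<subseteq> P"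
    unfolding openin_prod_topology_alt by metis
  \<comment> \<open>Since \<open>V\<close> lies in both sides of the rectangle, products of two
    elements of \<open>V\<close> fall into \<open>F\<close>; intersecting with \<open>F\<close>
    makes the elements themselves square to the identity.\<close>
  define V where "V = U \<inter> W \<inter> F"
  have V: "openin T V" "\<one>\<^bsub>G\<^esub> \<in> V"
    using UW opF top by (auto simp: V_def F)
  have VG: "V \<subseteq> carrier G"
    using V(1) openin_subset top by metis
  have sq: "a \<otimes>\<^bsub>G\<^esub> a = \<one>\<^bsub>G\<^esub>" if "a \<in> V" for a
    using that by (simp add: V_def F)
  have sq2: "(a \<otimes>\<^bsub>G\<^esub> b) \<otimes>\<^bsub>G\<^esub> (a \<otimes>\<^bsub>G\<^esub> b) = \<one>\<^bsub>G\<^esub>" if "a \<in> V" "b \<in> V" for a b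
  proof -
    have "(a, b) \<in> P"
      using that UW(5) by (auto simp: V_def)
    then show ?thesis
      by (simp add: P_def F)
  qed
  have "\<exists>H. subgroup H G \<and> V \<subseteq> H \<and> (\<forall>x\<in>H. x \<otimes>\<^bsub>G\<^esub> x = \<one>\<^bsub>G\<^esub>)"
    by (rule G.boolean_subgroup_containing[OF VG sq sq2])
  then obtain H where H: "subgroup H G" "V \<subseteq> H" "\<forall>x\<in>H. x \<otimes>\<^bsub>G\<^esub> x = \<one>\<^bsub>G\<^esub>"
    by (elim exE conjE)
  have op: "openin T H"
    by (rule topological_group_subgroup_open[OF assms(1) H(1) V H(2)])
  \<comment> \<open>Closedness of the open subgroup makes the results on clopen subspaces applicable
    to \<open>H\<close>.\<close>
  have clo: "closedin T H"
    by (rule topological_group_open_subgroup_closed[OF assms(1) H(1) op])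
  have "finite_covering_dim (subtopology T H)"
    using assms(6) covering_dim_le_clopen_subtopology[OF _ op clo]
    unfolding finite_covering_dim_def by (elim exE) blast
  moreover have "countable_pseudocharacter (G\<lparr>carrier := H\<rparr>) (subtopology T H)"
    using assms(7) subgroup.one_closed[OF H(1)]
    unfolding countable_pseudocharacter_def gdelta_in_subtopology
    by (intro exI[of _ "{\<one>\<^bsub>G\<^esub>}"]) auto
  ultimately show ?thesis
    using H op topological_group_subgroup[OF assms(1) H(1)]
      Hausdorff_space_subtopology[OF assms(2)] completely_regular_space_subtopology[OF assms(3)]
      paracompact_space_clopen_subtopology[OF assms(4) op clo]
      F_space_clopen_subtopology[OF assms(5) op clo]
    by (intro exI[of _ H] conjI)
qed

end
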